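(* On a single machine, no randomized non-preemptive online algorithm that does not know the number of jobs $n$ in advance achieves a competitive ratio of $o(n)$. Equivalently: for every such algorithm there exists a constant $C>0$ such that for every positive integer $n_0$ there is an instance $I$ with $n=|I|\ge n_0$ jobs and $\mathbb{E}[F(\mathrm{ALG}(I))]> C\cdot n\cdot \mathrm{OPT}(I)$.
   Context: Online single-machine scheduling; each job $j$ has release time $r_j\ge0$ and processing time $p_j\ge0$, and becomes known only at $r_j$; the algorithm does not know the total number of jobs. Non-preemptive: a started job runs to completion without interruption; the machine processes at most one job at a time. Flow time of $j$ is $C_j-r_j$; $F$ is total flow time. For this lower bound $\mathrm{OPT}(I)$ is the minimum total flow time over offline non-preemptive schedules of $I$. *)

theory Defs
  imports "HOL-Probability.Probability" "HOL-Library.Landau_Symbols"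
begin

datatype job = Job (release: real) (proc: real)

text \<open>
  An instance lists its jobs in the order in which they are revealed. Sortedness makes the position
  of a job carry no information about jobs that are released later.
\<close>

definition sched_instance :: "job list \<Rightarrow> bool" where
  "sched_instance I \<longleftrightarrow>
     sorted (map release I) \<and> (\<forall>j\<in>set I. 0 \<le> release j \<and> 0 \<le> proc j)"

text \<open>
  A non-preemptive schedule gives the start time of the job at each position; job \<open>i\<close> occupies
  the machine from \<open>s i\<close> until its completion time \<open>s i + proc (I ! i)\<close>. Jobs of processing time
  zero may share a time point, but may not lie strictly inside the execution of another job.
\<close>

definition feasible :: "job list \<Rightarrow> (nat \<Rightarrow> real) \<Rightarrow> bool" where
  "feasible I s \<longleftrightarrow>
     (\<forall>i<length I. release (I ! i) \<le> s i) \<and>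
     (\<forall>i<length I. \<forall>k<length I. i \<noteq> k \<longrightarrow>
        s i + proc (I ! i) \<le> s k \<or> s k + proc (I ! k) \<le> s i)"

definition flow_time :: "job list \<Rightarrow> (nat \<Rightarrow> real) \<Rightarrow> real" where
  "flow_time I s = (\<Sum>i<length I. (s i + proc (I ! i)) - release (I ! i))"

definition OPT :: "job list \<Rightarrow> real" where
  "OPT I = (INF s\<in>{s. feasible I s}. flow_time I s)"

definition known :: "real \<Rightarrow> job list \<Rightarrow> job list" where
  "known t I = filter (\<lambda>j. release j \<le> t) I"

text \<open>
  Two instances that agree on the jobs released up to time \<open>t\<close> cannot be told apart at time \<open>t\<close>,
  whatever their total numbers of jobs, so the same jobs are started at the same times up to \<open>t\<close>.
  On a sorted instance \<open>known t I\<close> is a prefix of \<open>I\<close>, so positions in the two agree.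
\<close>

definition non_anticipating :: "(job list \<Rightarrow> nat \<Rightarrow> real) \<Rightarrow> bool" where
  "non_anticipating A \<longleftrightarrow>
     (\<forall>I I' t. sched_instance I \<longrightarrow> sched_instance I' \<longrightarrow> known t I = known t I' \<longrightarrow>
        (\<forall>i<length (known t I). A I i \<le> t \<longrightarrow> A I' i = A I i))"

definition online_algorithm :: "(job list \<Rightarrow> nat \<Rightarrow> real) \<Rightarrow> bool" where
  "online_algorithm A \<longleftrightarrow>
     (\<forall>I. sched_instance I \<longrightarrow> feasible I (A I)) \<and> non_anticipating A"

text \<open>
  A randomized algorithm is a family of deterministic online algorithms indexed by a random seed
  drawn from \<open>M\<close>; the instance is fixed independently of the seed (oblivious adversary).
\<close>

definition randomized_online_algorithm ::
    "'w measure \<Rightarrow> ('w \<Rightarrow> job list \<Rightarrow> nat \<Rightarrow> real) \<Rightarrow> bool" where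
  "randomized_online_algorithm M A \<longleftrightarrow>
     prob_space M \<and>
     (\<forall>w\<in>space M. online_algorithm (A w)) \<and>
     (\<forall>I i. sched_instance I \<longrightarrow> i < length I \<longrightarrow> (\<lambda>w. A w I i) \<in> borel_measurable M)"

text \<open>The expectation is taken in \<open>ennreal\<close>, so that it may be infinite.\<close>

definition expected_flow_time ::
    "'w measure \<Rightarrow> ('w \<Rightarrow> job list \<Rightarrow> nat \<Rightarrow> real) \<Rightarrow> job list \<Rightarrow> ennreal" where
  "expected_flow_time M A I = (\<integral>\<^sup>+ w. ennreal (flow_time I (A w I)) \<partial>M)"

definition competitive ::
    "'w measure \<Rightarrow> ('w \<Rightarrow> job list \<Rightarrow> nat \<Rightarrow> real) \<Rightarrow> (nat \<Rightarrow> real) \<Rightarrow> bool" where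
  "competitive M A c \<longleftrightarrow>
     (\<forall>I. sched_instance I \<longrightarrow> expected_flow_time M A I \<le> ennreal (c (length I) * OPT I))"

end

(*
  Reveal a unit job at time 0. A randomized algorithm starts it at an almost surely finite time, so
  some interval [k/2, (k+1)/2] contains the start time with positive probability p, and p depends
  only on the algorithm. Releasing m jobs of length zero at time k/2 + 3/4 is not noticed before
  the unit job has started, so with probability p each of them waits at least 1/4 for it to
  complete. The optimum avoids any waiting of the zero jobs and has total flow time at most 2.
*)
theory Submission imports Defs begin

lemma flow_time_nonneg:
  assumes "sched_instance I" "feasible I s"
  shows "0 \<le> flow_time I s"
  unfolding flow_time_def
proof (rule sum_nonneg)
  fix i assume "i \<in> {..<length I}"
  with assms have "release (I ! i) \<le> s i" "0 \<le> proc (I ! i)"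
    by (auto simp: feasible_def sched_instance_def)
  then show "0 \<le> s i + proc (I ! i) - release (I ! i)" by simp
qed

lemma OPT_nonneg:
  assumes "sched_instance I" "feasible I s"
  shows "0 \<le> OPT I"
  unfolding OPT_def using assms by (intro cINF_greatest) (auto intro: flow_time_nonneg)

text \<open>A real infimum bounds a set from below only if the set is bounded below; nonnegativity
  of flow times supplies the bound 0.\<close>

lemma OPT_le_flow_time:
  assumes "sched_instance I" "feasible I s"
  shows "OPT I \<le> flow_time I s"
  unfolding OPT_def using assms
  by (intro cINF_lower bdd_belowI2[where m = 0]) (auto intro: flow_time_nonneg)

definition burst_instance :: "real \<Rightarrow> nat \<Rightarrow> job list" where
  "burst_instance R m = Job 0 1 # replicate m (Job R 0)"

lemma length_burst_instance [simp]: "length (burst_instance R m) = Suc m"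
  by (simp add: burst_instance_def)

lemma nth_burst_instance_0 [simp]: "burst_instance R m ! 0 = Job 0 1"
  by (simp add: burst_instance_def)

lemma nth_burst_instance_Suc [simp]: "i < m \<Longrightarrow> burst_instance R m ! Suc i = Job R 0"
  by (simp add: burst_instance_def)

lemma sched_instance_burst: "0 \<le> R \<Longrightarrow> sched_instance (burst_instance R m)"
  by (auto simp: burst_instance_def sched_instance_def map_replicate_const[symmetric])

lemma known_burst_instance:
  assumes "0 \<le> t" "t < R"
  shows "known t (burst_instance R m) = [Job 0 1]"
  using assms by (simp add: burst_instance_def known_def)

lemma flow_time_burst:
  "flow_time (burst_instance R m) s = s 0 + 1 + (\<Sum>i<m. s (Suc i) - R)"
  unfolding flow_time_def length_burst_instance sum.lessThan_Suc_shift by simp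

lemma OPT_burst_bounds:
  assumes "0 \<le> R"
  shows "0 \<le> OPT (burst_instance R m)" "OPT (burst_instance R m) \<le> 2"
proof -
  \<comment> \<open>If \<open>R \<ge> 1\<close>, the unit job runs at 0 and is done by
    \<open>R\<close>. Otherwise it waits and starts at \<open>R\<close>, where the zero jobs share
    its start point, and its flow time is \<open>R + 1 < 2\<close>. No zero job waits in either
    case.\<close>
  define s :: "nat \<Rightarrow> real" where "s i = (if i = 0 \<and> R \<ge> 1 then 0 else R)" for i
  have feas: "feasible (burst_instance R m) s"
    using assms by (auto simp: feasible_def s_def less_Suc_eq_0_disj)
  have "flow_time (burst_instance R m) s \<le> 2"
    by (auto simp: flow_time_burst s_def)
  then show "0 \<le> OPT (burst_instance R m)" "OPT (burst_instance R m) \<le> 2"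
    using OPT_nonneg[OF sched_instance_burst[OF assms] feas]
      OPT_le_flow_time[OF sched_instance_burst[OF assms] feas] by auto
qed

text \<open>A unit job started before \<open>R\<close> cannot be interrupted, and no zero job can
  precede it, so each zero job starts at \<open>s 0 + 1\<close> or later. The unit job's own flow
  time is dropped.\<close>

lemma flow_time_burst_ge:
  assumes feas: "feasible (burst_instance R m) s" and "s 0 < R"
  shows "real m * (s 0 + 1 - R) \<le> flow_time (burst_instance R m) s"
proof -
  have "s 0 + 1 - R \<le> s (Suc i) - R" if "i < m" for i
  proof -
    have "R \<le> s (Suc i)"
      using feas that by (force simp: feasible_def)
    moreover have "s 0 + 1 \<le> s (Suc i) \<or> s (Suc i) \<le> s 0"
    proof -
      have "0 < length (burst_instance R m)" "Suc i < length (burst_instance R m)"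
        using that by auto
      then have "s 0 + proc (burst_instance R m ! 0) \<le> s (Suc i) \<or>
          s (Suc i) + proc (burst_instance R m ! Suc i) \<le> s 0"
        using feas unfolding feasible_def by blast
      then show ?thesis using that by simp
    qed
    ultimately show ?thesis using \<open>s 0 < R\<close> by simp
  qed
  then have "(\<Sum>i<m. s 0 + 1 - R) \<le> (\<Sum>i<m. s (Suc i) - R)"
    by (intro sum_mono) auto
  moreover have "0 \<le> s 0"
    using feas by (force simp: feasible_def)
  ultimately show ?thesis by (simp add: flow_time_burst)
qed

text \<open>Before \<open>R\<close> the burst looks like the instance with the unit job alone, so a
  start decided by time \<open>t\<close> is the same for every \<open>m\<close>. This is where
  ignorance of the number of jobs enters.\<close>

lemma start_time_burst:
  assumes A: "online_algorithm A" and "0 \<le> t" "t < R" "A [Job 0 1] 0 \<le> t"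
  shows "A (burst_instance R m) 0 = A [Job 0 1] 0"
proof -
  have "sched_instance [Job 0 1]" by (simp add: sched_instance_def)
  moreover have "sched_instance (burst_instance R m)"
    using assms by (intro sched_instance_burst) simp
  moreover have "known t [Job 0 1] = known t (burst_instance R m)"
    using assms by (simp add: known_burst_instance) (simp add: known_def)
  moreover have "0 < length (known t [Job 0 1])"
    using assms by (simp add: known_def)
  ultimately show ?thesis
    using A assms(4) unfolding online_algorithm_def non_anticipating_def by blast
qed

text \<open>\<open>C\<close> is fixed before \<open>n\<close>, and every length from 2 on is
  attained, so \<open>n\<close> can later be taken beyond any threshold. The conjunct
  \<open>0 \<le> OPT I\<close> permits multiplying bounds on the ratio by
  \<open>OPT I\<close>.\<close>

lemma linear_lower_bound:
  fixes M :: "'w measure" and A :: "'w \<Rightarrow> job list \<Rightarrow> nat \<Rightarrow> real"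
  assumes "randomized_online_algorithm M A"
  obtains C :: real where "C > 0"
    and "\<And>n. n \<ge> 2 \<Longrightarrow> \<exists>I. sched_instance I \<and> length I = n \<and> 0 \<le> OPT I \<and>
      ennreal (C * real n * OPT I) < expected_flow_time M A I"
proof -
  interpret prob_space M
    using assms by (simp add: randomized_online_algorithm_def)
  have alg: "online_algorithm (A w)" if "w \<in> space M" for w
    using assms that by (simp add: randomized_online_algorithm_def)
  have sched1: "sched_instance [Job 0 1]" by (simp add: sched_instance_def)
  define S where "S w = A w [Job 0 1] 0" for w
  have [measurable]: "S \<in> borel_measurable M"
    using assms sched1 unfolding randomized_online_algorithm_def S_def by force
  have S_nonneg: "0 \<le> S w" if "w \<in> space M" for w
    using alg[OF that] sched1 by (force simp: online_algorithm_def feasible_def S_def)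
  \<comment> \<open>Intervals of length 1/2, shorter than the unit job, leave room for a release
    time after the whole interval but before the job can complete.\<close>
  define E where "E k = {w \<in> space M. real k / 2 \<le> S w \<and> S w \<le> (real k + 1) / 2}" for k
  have E_meas [measurable]: "E k \<in> sets M" for k unfolding E_def by measurable
  have "\<exists>k. w \<in> E k" if "w \<in> space M" for w
  proof
    show "w \<in> E (nat \<lfloor>2 * S w\<rfloor>)"
      using S_nonneg[OF that] that unfolding E_def by (simp; linarith)
  qed
  then have UN_E: "(\<Union>k. E k) = space M" by (auto simp: E_def)
  \<comment> \<open>Countably many null events cannot cover a space of probability 1.\<close>
  obtain k where k: "emeasure M (E k) \<noteq> 0"
  proof (rule ccontr)
    assume "\<not> thesis"
    with that have "emeasure M (E k) = 0" for k by blast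
    then have "emeasure M (\<Union>k. E k) = 0" by (intro emeasure_UN_eq_0) auto
    then show False using emeasure_space_1 by (simp add: UN_E)
  qed
  define p where "p = measure M (E k)"
  have p: "emeasure M (E k) = ennreal p" "p > 0"
    using k by (auto simp: p_def emeasure_eq_measure zero_less_measure_iff)
  \<comment> \<open>This lies 1/4 after the latest start in \<open>E k\<close> and 1/4 before the
    earliest completion \<open>real k / 2 + 1\<close>.\<close>
  define R where "R = real k / 2 + 3 / 4"
  have "R \<ge> 0" by (simp add: R_def)
  show ?thesis
  proof (rule that)
    \<comment> \<open>With \<open>n = m + 1 \<le> 2 * m\<close> and \<open>OPT \<le> 2\<close>, this
      constant gives at most \<open>p * m / 8\<close>, strictly below the expected waiting bound
      \<open>p * m / 4\<close>.\<close>
    show "p / 32 > 0" using p by simp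
  next
    fix n :: nat assume "n \<ge> 2"
    then obtain m where n: "n = Suc m" and "m \<ge> 1" by (cases n) auto
    let ?I = "burst_instance R m"
    have sched: "sched_instance ?I" by (rule sched_instance_burst[OF \<open>R \<ge> 0\<close>])
    note OPT = OPT_burst_bounds[OF \<open>R \<ge> 0\<close>, of m]
    have flow: "ennreal (real m / 4) * indicator (E k) w \<le> ennreal (flow_time ?I (A w ?I))"
      if w: "w \<in> space M" for w
    proof (cases "w \<in> E k")
      case True
      then have S: "real k / 2 \<le> S w" "S w \<le> (real k + 1) / 2" by (auto simp: E_def)
      have start: "A w ?I 0 = S w"
        unfolding S_def using alg[OF w] S(2)
        \<comment> \<open>The right end of the interval serves for all seeds in \<open>E k\<close>:
          the unit job has started by then, and the burst is still unseen.\<close>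
        by (intro start_time_burst[where t = "(real k + 1) / 2"])
          (auto simp: S_def R_def field_simps)
      have "feasible ?I (A w ?I)"
        using alg[OF w] sched by (simp add: online_algorithm_def)
      then have "real m * (S w + 1 - R) \<le> flow_time ?I (A w ?I)"
        using flow_time_burst_ge[of R m "A w ?I"] S start by (simp add: R_def field_simps)
      moreover have "real m * (1 / 4) \<le> real m * (S w + 1 - R)"
        using S by (intro mult_left_mono) (auto simp: R_def)
      ultimately show ?thesis using True by (simp add: ennreal_leI)
    qed simp
    have "p / 32 * real n * OPT ?I \<le> p / 32 * real n * 2"
      using OPT p by (intro mult_left_mono) auto
    also have "\<dots> \<le> p * real m / 8"
      using p \<open>m \<ge> 1\<close> by (simp add: n field_simps)
    also have "\<dots> < real m / 4 * p"
      using p \<open>m \<ge> 1\<close> by simp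
    finally have "ennreal (p / 32 * real n * OPT ?I) < ennreal (real m / 4 * p)"
      using p \<open>m \<ge> 1\<close> by (simp add: ennreal_less_iff OPT)
    also have "\<dots> = (\<integral>\<^sup>+ w. ennreal (real m / 4) * indicator (E k) w \<partial>M)"
      using p by (simp add: nn_integral_cmult_indicator flip: ennreal_mult)
    also have "\<dots> \<le> expected_flow_time M A ?I"
      unfolding expected_flow_time_def by (rule nn_integral_mono) (rule flow)
    finally show "\<exists>I. sched_instance I \<and> length I = n \<and> 0 \<le> OPT I \<and>
        ennreal (p / 32 * real n * OPT I) < expected_flow_time M A I"
      using sched OPT n by (intro exI[of _ ?I]) simp
  qed
qed

theorem mainTheorem10:
  fixes M :: "'w measure" and A :: "'w \<Rightarrow> job list \<Rightarrow> nat \<Rightarrow> real"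
  assumes "randomized_online_algorithm M A"
  shows "\<not> (\<exists>c \<in> o(\<lambda>n::nat. real n). competitive M A c) \<and>
    (\<exists>C::real. C > 0 \<and> (\<forall>n0::nat. n0 \<ge> 1 \<longrightarrow>
       (\<exists>I. sched_instance I \<and> length I \<ge> n0 \<and>
          expected_flow_time M A I > ennreal (C * real (length I) * OPT I))))"
proof -
  obtain C :: real where "C > 0"
    and C: "\<And>n. n \<ge> 2 \<Longrightarrow> \<exists>I. sched_instance I \<and> length I = n \<and> 0 \<le> OPT I \<and>
      ennreal (C * real n * OPT I) < expected_flow_time M A I"
    using linear_lower_bound[OF assms] by blast
  have "\<not> competitive M A c" if "c \<in> o(\<lambda>n::nat. real n)" for c
  proof
    assume comp: "competitive M A c"
    have "\<forall>\<^sub>F n in sequentially. norm (c n) \<le> C * norm (real n)"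
      using landau_o.smallD[OF that \<open>C > 0\<close>] .
    then obtain N where N: "\<And>n. n \<ge> N \<Longrightarrow> \<bar>c n\<bar> \<le> C * real n"
      by (auto simp: eventually_sequentially)
    \<comment> \<open>Past \<open>N\<close> the little-o bound with constant \<open>C\<close> holds;
      2 is the least length covered by the lower bound.\<close>
    define n where "n = max N 2"
    obtain I where I: "sched_instance I" "length I = n" "0 \<le> OPT I"
      "ennreal (C * real n * OPT I) < expected_flow_time M A I"
      using C[of n] by (auto simp: n_def)
    have "c n \<le> C * real n" using N[of n] by (simp add: n_def)
    then have "ennreal (c n * OPT I) \<le> ennreal (C * real n * OPT I)"
      using I by (intro ennreal_leI mult_right_mono) auto
    moreover have "expected_flow_time M A I \<le> ennreal (c n * OPT I)"
      using comp I by (auto simp: competitive_def)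
    ultimately show False using I(4) by simp
  qed
  moreover have "\<exists>I. sched_instance I \<and> length I \<ge> n0 \<and>
      expected_flow_time M A I > ennreal (C * real (length I) * OPT I)" for n0
    using C[of "max n0 2"] by (metis max.cobounded1 max.cobounded2)
  ultimately show ?thesis using \<open>C > 0\<close> by blast
qed

end
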